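(* Let $d\ge2$ and $k\ge1$ be integers, $m=k(d-1)$, and let $\mu$ be the Cantor-like self-similar measure (of finite type) generated by the IFS $S_j(x)=\frac1d x+\frac{j}{md}(d-1)$, $j=0,\dots,m$, with probabilities $p_j>0$, $\sum_{j=0}^m p_j=1$. Then (terminology in the context): (1) The essential class has exactly one reduced characteristic vector $E$, with normalized length $1/k$ and neighbour set $(j/k: j=0,\dots,k-1)$. $E$ has $d$ children, all with reduced characteristic vector $E$; label them from left to right $E^{(1)},\dots,E^{(d)}$. (2) There are exactly $m-k+2$ net intervals of level one with reduced characteristic vector $E$, namely the consecutive intervals $\left[\frac{k-1}{kd},\frac{k}{kd}\right],\dots,\left[1-\frac{k}{kd},1-\frac{k-1}{kd}\right]$ (each of length $\frac1{kd}$). (3) For $i=1,\dots,d$, the primitive transition matrix $T(E,E^{(i)})$ is given, for $x,y=0,\dots,k-1$ (rows and columns indexed by $0,\dots,k-1$, index $x$ corresponding to the neighbour $x/k$), by $$(T(E,E^{(i)}))_{x,y}=\begin{cases}p_{dx-y+i-1}&\text{if }0\le dx-y+i-1\le m,\\0&\text{otherwise.}\end{cases}$$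
   Context: Write $\varrho=1/d$, $\mathcal A=\{0,\dots,m\}$, and $S_\sigma=S_{j_1}\circ\cdots\circ S_{j_n}$ for $\sigma=(j_1,\dots,j_n)\in\mathcal A^n$. $\mu$ is the unique Borel probability measure with $\mu=\sum_j p_j\,\mu\circ S_j^{-1}$; its support is the self-similar set $K$, which here is $[0,1]$. Net intervals. Let $h_1<\dots<h_{s_n}$ be the elements of $\{S_\sigma(0),S_\sigma(1):\sigma\in\mathcal A^n\}$; the net intervals of level $n$ are the intervals $[h_j,h_{j+1}]$ with $(h_j,h_{j+1})\cap K\neq\emptyset$ (level $0$: $[0,1]$). Each net interval $\Delta$ of level $n\ge1$ is contained in a unique net interval $\widehat\Delta$ of level $n-1$, its parent ($\Delta$ is a child of $\widehat\Delta$). For a level $n$ net interval $\Delta=[a,b]$: normalized length $\ell_n(\Delta)=\varrho^{-n}(b-a)$; neighbour set $V_n(\Delta)$ = the increasingly ordered tuple of the distinct elements of $\{\varrho^{-n}(a-S_\sigma(0)):\sigma\in\mathcal A^n,\ \Delta\subseteq S_\sigma[0,1]\}$; $r_n(\Delta)$ = position of $\Delta$, from left to right, among the level $n$ net intervals with the same parent and the same normalized length. The characteristic vector is $(\ell_n(\Delta),V_n(\Delta),r_n(\Delta))$ and the reduced characteristic vector is $(\ell_n(\Delta),V_n(\Delta))$. There are finitely many characteristic vectors (set $\Omega$), and those of the children depend only on that of the parent. A loop class is a non-empty $\Omega'\subseteq\Omega$ such that any $\alpha,\beta\in\Omega'$ are joined by a path from $\alpha$ to $\beta$ in $\Omega'$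 in which each letter is the parent of the next; it is an essential class if moreover all children of elements of $\Omega'$ are in $\Omega'$. There is exactly one essential class (known). Primitive transition matrix. For a level $n$ net interval $\Delta=[a,b]$ with parent $\widehat\Delta=[c,c']$, $V_n(\Delta)=(a_1,\dots,a_N)$, $V_{n-1}(\widehat\Delta)=(c_1,\dots,c_M)$, it is the $M\times N$ matrix whose $jl$ entry is $p_w$ if there are $w\in\mathcal A$ and $\sigma\in\mathcal A^{n-1}$ with $S_\sigma(0)=c-\varrho^{n-1}c_j$ and $S_{\sigma w}(0)=a-\varrho^n a_l$, and $0$ otherwise. *)

theory Defs
  imports "HOL-Probability.Probability_Measure" "Jordan_Normal_Form.Matrix"
begin

definition cantor_ifs :: "nat \<Rightarrow> nat \<Rightarrow> nat \<Rightarrow> real \<Rightarrow> real" where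
  "cantor_ifs d m j x = (1 / real d) * x + real j / (real m * real d) * (real d - 1)"

definition self_similar_measure ::
  "(nat \<Rightarrow> real \<Rightarrow> real) \<Rightarrow> nat \<Rightarrow> (nat \<Rightarrow> real) \<Rightarrow> real measure \<Rightarrow> bool" where
  "self_similar_measure S m p \<mu> \<longleftrightarrow>
     prob_space \<mu> \<and> sets \<mu> = sets borel \<and>
     (\<forall>A\<in>sets borel. measure \<mu> A = (\<Sum>j\<le>m. p j * measure \<mu> (S j -` A)))"

definition measure_support :: "real measure \<Rightarrow> real set" where
  "measure_support \<mu> = {x. \<forall>U. open U \<and> x \<in> U \<longrightarrow> 0 < measure \<mu> U}"

text \<open>
  In the following context, \<open>S\<close> is an iterated function system with index set
  \<open>{0..m}\<close> and common contraction ratio \<open>\<rho>\<close>, and \<open>K\<close> is its self-similar set.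
  A closed interval is encoded by the pair of its endpoints.
\<close>

context
  fixes S :: "nat \<Rightarrow> real \<Rightarrow> real" and m :: nat and \<rho> :: real and K :: "real set"
begin

definition words :: "nat \<Rightarrow> nat list set" where
  "words n = {\<sigma>. length \<sigma> = n \<and> set \<sigma> \<subseteq> {0..m}}"

definition word_map :: "nat list \<Rightarrow> real \<Rightarrow> real" where
  "word_map \<sigma> = foldr (\<lambda>j f. S j \<circ> f) \<sigma> id"

definition endpoints :: "nat \<Rightarrow> real set" where
  "endpoints n = (\<lambda>\<sigma>. word_map \<sigma> 0) ` words n \<union> (\<lambda>\<sigma>. word_map \<sigma> 1) ` words n"

definition net_intervals :: "nat \<Rightarrow> (real \<times> real) set" where
  "net_intervals n = {(a, b). a \<in> endpoints n \<and> b \<in> endpoints n \<and> a < b \<and>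
     {a<..<b} \<inter> endpoints n = {} \<and> {a<..<b} \<inter> K \<noteq> {}}"

definition children :: "nat \<Rightarrow> real \<times> real \<Rightarrow> (real \<times> real) set" where
  "children n D = {I \<in> net_intervals (Suc n). {fst I..snd I} \<subseteq> {fst D..snd D}}"

definition normalized_length :: "nat \<Rightarrow> real \<times> real \<Rightarrow> real" where
  "normalized_length n I = (snd I - fst I) / \<rho> ^ n"

definition neighbour_set :: "nat \<Rightarrow> real \<times> real \<Rightarrow> real list" where
  "neighbour_set n I = sorted_list_of_set
     {(fst I - word_map \<sigma> 0) / \<rho> ^ n | \<sigma>.
        \<sigma> \<in> words n \<and> {fst I..snd I} \<subseteq> word_map \<sigma> ` {0..1}}"

text \<open>
  The position among the siblings of the same normalized length; \<open>D\<close> is the parent.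
  The unique net interval of level 0 has no parent and gets position 1.
\<close>

definition sibling_rank :: "nat \<Rightarrow> real \<times> real \<Rightarrow> nat" where
  "sibling_rank n I = (case n of 0 \<Rightarrow> 1 | Suc n' \<Rightarrow>
     card {J. (\<exists>D\<in>net_intervals n'. I \<in> children n' D \<and> J \<in> children n' D) \<and>
       normalized_length n J = normalized_length n I \<and> fst J \<le> fst I})"

definition reduced_char_vector :: "nat \<Rightarrow> real \<times> real \<Rightarrow> real \<times> real list" where
  "reduced_char_vector n I = (normalized_length n I, neighbour_set n I)"

definition char_vector :: "nat \<Rightarrow> real \<times> real \<Rightarrow> real \<times> real list \<times> nat" where
  "char_vector n I = (normalized_length n I, neighbour_set n I, sibling_rank n I)"

definition char_vectors :: "(real \<times> real list \<times> nat) set" where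
  "char_vectors = {char_vector n I | n I. I \<in> net_intervals n}"

definition child_rel :: "((real \<times> real list \<times> nat) \<times> (real \<times> real list \<times> nat)) set" where
  "child_rel = {(char_vector n D, char_vector (Suc n) I) | n D I.
     D \<in> net_intervals n \<and> I \<in> children n D}"

definition loop_class :: "(real \<times> real list \<times> nat) set \<Rightarrow> bool" where
  "loop_class L \<longleftrightarrow> L \<noteq> {} \<and> L \<subseteq> char_vectors \<and>
     (\<forall>\<alpha>\<in>L. \<forall>\<beta>\<in>L. (\<alpha>, \<beta>) \<in> (child_rel \<inter> L \<times> L)\<^sup>+)"

definition essential_class :: "(real \<times> real list \<times> nat) set \<Rightarrow> bool" where
  "essential_class L \<longleftrightarrow> loop_class L \<and> (\<forall>\<alpha>\<in>L. \<forall>\<beta>. (\<alpha>, \<beta>) \<in> child_rel \<longrightarrow> \<beta> \<in> L)"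

text \<open>
  Transition from a net interval \<open>D\<close> of level \<open>n\<close> to its child \<open>I\<close> of level \<open>Suc n\<close>.
  The letter \<open>w\<close> is unique when the points \<open>S j 0\<close> are distinct.
\<close>

definition transition_letter ::
  "nat \<Rightarrow> real \<times> real \<Rightarrow> real \<times> real \<Rightarrow> nat \<Rightarrow> nat \<Rightarrow> nat \<Rightarrow> bool" where
  "transition_letter n D I j l w \<longleftrightarrow> w \<in> {0..m} \<and>
     (\<exists>\<sigma>\<in>words n. word_map \<sigma> 0 = fst D - \<rho> ^ n * neighbour_set n D ! j \<and>
        word_map (\<sigma> @ [w]) 0 = fst I - \<rho> ^ Suc n * neighbour_set (Suc n) I ! l)"

definition transition_matrix ::
  "(nat \<Rightarrow> real) \<Rightarrow> nat \<Rightarrow> real \<times> real \<Rightarrow> real \<times> real \<Rightarrow> real mat" where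
  "transition_matrix p n D I =
     mat (length (neighbour_set n D)) (length (neighbour_set (Suc n) I))
       (\<lambda>(j, l). if \<exists>w. transition_letter n D I j l w
          then p (THE w. transition_letter n D I j l w) else 0)"

end

definition reduce :: "real \<times> real list \<times> nat \<Rightarrow> real \<times> real list" where
  "reduce \<gamma> = (case \<gamma> of (len, V, r) \<Rightarrow> (len, V))"

end

theory Submission
  imports Defs
begin

text \<open>
  Since \<open>m = k (d - 1)\<close>, the maps are \<open>S j x = (x + j / k) / d\<close>, so a word \<open>\<sigma>\<close> of length \<open>n\<close> acts as
  \<open>x \<mapsto> (x + N / k) / d ^ n\<close> with \<open>N\<close> the value of the digit string \<open>\<sigma>\<close> in base \<open>d\<close>. As
  \<open>m \<ge> d - 1\<close>, these values fill \<open>{0..k (d ^ n - 1)}\<close>, so for \<open>n \<ge> 1\<close> the net intervals are exactly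
  the cells \<open>[i, i + 1] / (k d ^ n)\<close> of a regular grid. Cell \<open>i\<close> has the neighbours \<open>j / k\<close> with
  \<open>0 \<le> i - j \<le> k (d ^ n - 1)\<close> and \<open>j < k\<close>, hence has reduced vector \<open>E\<close> iff
  \<open>k - 1 \<le> i \<le> k (d ^ n - 1)\<close>, that is, iff it is not too close to the boundary. Its children are the
  cells \<open>d i, \<dots>, d i + d - 1\<close>, so being of type \<open>E\<close> is inherited, and every cell has a
  descendant of type \<open>E\<close>.
\<close>

section \<open>General facts on words, self-similar measures and essential classes\<close>

lemma word_map_simps [simp]:
  "word_map S [] = id"
  "word_map S (j # \<sigma>) = S j \<circ> word_map S \<sigma>"
  by (simp_all add: word_map_def)

lemma word_map_append: "word_map S (\<sigma> @ \<tau>) = word_map S \<sigma> \<circ> word_map S \<tau>"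
  by (induction \<sigma>) (simp_all add: comp_assoc)

lemma words_0: "words m 0 = {[]}"
  by (auto simp: words_def)

lemma append_in_words_iff: "\<sigma> @ [w] \<in> words m (Suc n) \<longleftrightarrow> \<sigma> \<in> words m n \<and> w \<le> m"
  by (auto simp: words_def)

lemma words_Suc: "words m (Suc n) = (\<lambda>(\<sigma>, w). \<sigma> @ [w]) ` (words m n \<times> {..m})"
proof (intro equalityI subsetI)
  fix \<tau> assume \<tau>: "\<tau> \<in> words m (Suc n)"
  then obtain \<sigma> w where "\<tau> = \<sigma> @ [w]"
    by (cases \<tau> rule: rev_cases) (auto simp: words_def)
  with \<tau> show "\<tau> \<in> (\<lambda>(\<sigma>, w). \<sigma> @ [w]) ` (words m n \<times> {..m})"
    by (force simp: append_in_words_iff)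
qed (auto simp: append_in_words_iff)

text \<open>All summands in the self-similarity relation are nonnegative, and the one with index
  \<open>j\<close> is positive once the preimage of \<open>A\<close> under \<open>S j\<close> has
  positive measure. Iterating this along the letters of \<open>\<sigma>\<close> treats the whole
  word.\<close>

lemma self_similar_measure_pos:
  assumes \<mu>: "self_similar_measure S m p \<mu>"
    and p: "\<And>j. j \<le> m \<Longrightarrow> p j > 0"
    and S: "\<And>j. S j \<in> borel_measurable borel"
    and \<sigma>: "set \<sigma> \<subseteq> {0..m}" and A: "A \<in> sets borel"
    and pos: "measure \<mu> (word_map S \<sigma> -` A) > 0"
  shows "measure \<mu> A > 0"
  using \<sigma> A pos
proof (induction \<sigma> arbitrary: A)
  case (Cons j \<sigma>)
  have "S j -` A \<in> sets borel"
    using measurable_sets[OF S Cons.prems(2), of j] by simp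
  moreover have "measure \<mu> (word_map S \<sigma> -` (S j -` A)) > 0"
    using Cons.prems(3) by (simp add: vimage_def)
  ultimately have "measure \<mu> (S j -` A) > 0"
    using Cons.IH Cons.prems(1) by simp
  then have "0 < (\<Sum>j\<le>m. p j * measure \<mu> (S j -` A))"
    using Cons.prems(1) p
    by (intro sum_pos2[of _ j]) (auto intro!: mult_nonneg_nonneg intro: less_imp_le)
  then show ?case
    using \<mu> Cons.prems(2) by (simp add: self_similar_measure_def)
qed simp

text \<open>The symmetric intervals exhaust the line, so they cannot all be null. This supplies a
  bounded set of positive mass, which long words then contract into any prescribed interval inside
  \<open>{0<..<1}\<close>.\<close>

lemma bounded_interval_pos:
  assumes "prob_space \<mu>" and sets: "sets \<mu> = sets borel"
  shows "\<exists>R::nat. measure \<mu> {- real R..real R} > 0"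
proof (rule ccontr)
  interpret prob_space \<mu> by fact
  assume "\<nexists>R::nat. measure \<mu> {- real R..real R} > 0"
  then have 0: "measure \<mu> {- real R..real R} = 0" for R
    by (metis measure_nonneg order_le_less)
  have "(\<Union>R. {- real R..real R}) = UNIV"
  proof (intro equalityI subsetI)
    fix x :: real
    obtain R where "\<bar>x\<bar> \<le> real R" using real_arch_simple by blast
    then show "x \<in> (\<Union>R. {- real R..real R})" by (auto simp: abs_le_iff intro!: exI[of _ R])
  qed simp
  moreover have "measure \<mu> (\<Union>R. {- real R..real R}) = 0"
    by (rule measure_eq_0_null_sets, rule null_sets_UN)
      (auto simp: null_sets_def sets emeasure_eq_measure 0)
  moreover have "space \<mu> = UNIV" using sets_eq_imp_space_eq[OF sets] by simp
  ultimately show False using prob_space by simp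
qed

text \<open>From a shared vector every element of \<open>L\<close> is reached by a path of children,
  and a path starting in \<open>L'\<close> cannot leave it, as \<open>L'\<close> is closed under
  children.\<close>

lemma essential_class_subset:
  assumes L: "essential_class S m \<rho> K L" and L': "essential_class S m \<rho> K L'"
    and "L \<inter> L' \<noteq> {}"
  shows "L \<subseteq> L'"
proof
  fix \<gamma> assume "\<gamma> \<in> L"
  moreover obtain \<beta> where "\<beta> \<in> L" "\<beta> \<in> L'" using assms(3) by blast
  ultimately have "(\<beta>, \<gamma>) \<in> (child_rel S m \<rho> K \<inter> L \<times> L)\<^sup>+"
    using L by (simp add: essential_class_def loop_class_def)
  then show "\<gamma> \<in> L'"
    using \<open>\<beta> \<in> L'\<close> L' by (induction rule: trancl_induct) (auto simp: essential_class_def)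
qed

section \<open>Digit strings in base \<open>d\<close> and the support of the measure\<close>

locale cantor_numeration =
  fixes d k m :: nat and S :: "nat \<Rightarrow> real \<Rightarrow> real"
  assumes d: "d \<ge> 2" and k: "k \<ge> 1" and m: "m = k * (d - 1)" and S: "S = cantor_ifs d m"
begin

text \<open>\<open>horner_sum\<close> expects the least significant digit first, hence
  \<open>rev\<close>. Digits run up to \<open>m\<close>, which may exceed \<open>d - 1\<close>, so
  different words of one length can share a value.\<close>

definition digit_value :: "nat list \<Rightarrow> nat" where
  "digit_value \<sigma> = horner_sum id d (rev \<sigma>)"

lemma digit_value_simps [simp]:
  "digit_value [] = 0" "digit_value (\<sigma> @ [w]) = d * digit_value \<sigma> + w"
  by (simp_all add: digit_value_def)

lemma S_eq: "S j x = (x + real j / real k) / real d"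
proof -
  have "real m = real k * (real d - 1)" using m d by (simp add: of_nat_diff)
  moreover have "real d - 1 \<noteq> 0" using d by simp
  ultimately have "real j / (real m * real d) * (real d - 1) = real j / real k / real d"
    by simp
  then show ?thesis by (simp add: S cantor_ifs_def add_divide_distrib)
qed

lemma word_map_eq: "word_map S \<sigma> x = (x + real (digit_value \<sigma>) / real k) / real d ^ length \<sigma>"
proof (induction \<sigma> arbitrary: x rule: rev_induct)
  case (snoc w \<sigma>)
  then show ?case using d k by (simp add: word_map_append S_eq field_simps)
qed simp

text \<open>Appending a digit to consecutive values yields blocks that start \<open>d\<close> apart
  and have length \<open>m + 1 \<ge> d\<close>, so no value is skipped.\<close>

lemma digit_value_words: "digit_value ` words m n = {..k * (d ^ n - 1)}"
proof (induction n)
  case (Suc n)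
  let ?B = "k * (d ^ n - 1)"
  have "digit_value ` words m (Suc n) = (\<lambda>(N, w). d * N + w) ` ((digit_value ` words m n) \<times> {..m})"
    by (force simp: words_Suc)
  also have "\<dots> = (\<lambda>(N, w). d * N + w) ` ({..?B} \<times> {..m})" using Suc by simp
  also have "\<dots> = {..d * ?B + m}"
  proof (intro equalityI subsetI)
    fix x assume x: "x \<in> {..d * ?B + m}"
    \<comment> \<open>Below the cap this is division with remainder. At the top of the range the
      quotient is cut off at \<open>?B\<close>, and the last digit may exceed \<open>d - 1\<close>
      but not \<open>m\<close>.\<close>
    define N where "N = min ?B (x div d)"
    have "d - 1 \<le> m" using m k by simp
    moreover have "x mod d < d" using d by simp
    ultimately have "x mod d \<le> m" by linarith
    then have "d * N \<le> x \<and> x - d * N \<le> m"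
    proof (cases "x div d \<le> ?B")
      case True
      then show ?thesis using \<open>x mod d \<le> m\<close>
        by (simp add: N_def min_absorb2 minus_mult_div_eq_mod)
    next
      case False
      then have "d * ?B \<le> d * (x div d)" by (intro mult_le_mono) auto
      also have "\<dots> \<le> x" by simp
      finally show ?thesis using False x by (simp add: N_def)
    qed
    then show "x \<in> (\<lambda>(N, w). d * N + w) ` ({..?B} \<times> {..m})"
      by (intro image_eqI[of _ _ "(N, x - d * N)"]) (auto simp: N_def)
  qed (auto intro!: add_mono mult_le_mono)
  also have "d * ?B + m = k * (d ^ Suc n - 1)"
  proof -
    have "int (d * ?B + m) = int (k * (d ^ Suc n - 1))"
      using d by (simp add: m of_nat_diff algebra_simps)
    then show ?thesis by linarith
  qed
  finally show ?case .
qed (simp add: words_0)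

text \<open>Near any point of \<open>{0<..<1}\<close> some word maps a bounded set of positive mass
  into the given neighbourhood, which therefore has positive mass itself.\<close>

lemma open_unit_interval_in_support:
  assumes \<mu>: "self_similar_measure S m p \<mu>" and p: "\<And>j. j \<le> m \<Longrightarrow> p j > 0"
  shows "{0<..<1} \<subseteq> measure_support \<mu>"
proof
  fix x :: real assume x: "x \<in> {0<..<1}"
  have "measure \<mu> U > 0" if U: "open U" "x \<in> U" for U
  proof -
    interpret prob_space \<mu> using \<mu> by (simp add: self_similar_measure_def)
    have sets: "sets \<mu> = sets borel" using \<mu> by (simp add: self_similar_measure_def)
    have "open (U \<inter> {0<..<1})" using U by auto
    then obtain e where e: "e > 0" "ball x e \<subseteq> U \<inter> {0<..<1}"
      using U x by (meson IntI open_contains_ball)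
    define a b where "a = x - e / 2" and "b = x + e / 2"
    have ab: "a < b" using e by (simp add: a_def b_def)
    have abU: "{a..b} \<subseteq> U \<inter> {0<..<1}"
    proof
      fix y assume "y \<in> {a..b}"
      then have "y \<in> ball x e" using e(1) by (auto simp: a_def b_def dist_real_def)
      then show "y \<in> U \<inter> {0<..<1}" using e(2) by blast
    qed
    have "a \<in> {a..b}" "b \<in> {a..b}" using ab by auto
    then have "0 < a" "b < 1" using abU by auto
    obtain R :: nat where R: "measure \<mu> {- real R..real R} > 0"
      using bounded_interval_pos[OF prob_space_axioms sets] by blast
    have "1 < real d" using d by simp
    \<comment> \<open>At this scale the window from \<open>a * real d ^ n + real R\<close> to
      \<open>b * real d ^ n - real R\<close> is longer than 1, so it contains an integer
      \<open>q\<close>. The map sending \<open>x\<close> to \<open>(x + q) / d ^ n\<close> then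
      takes \<open>{- real R..real R}\<close> into \<open>{a..b}\<close>.\<close>
    then obtain n where n: "(2 * real R + 1) / (b - a) < real d ^ n"
      using real_arch_pow by blast
    then have n': "2 * real R + 1 < b * real d ^ n - a * real d ^ n"
      using ab by (simp add: field_simps)
    define q where "q = nat \<lfloor>a * real d ^ n + real R\<rfloor> + 1"
    have pos: "0 \<le> a * real d ^ n + real R" using \<open>0 < a\<close> by simp
    then have "real q = real_of_int \<lfloor>a * real d ^ n + real R\<rfloor> + 1"
      unfolding q_def by (simp only: of_nat_add of_nat_1 of_nat_nat zero_le_floor)
    then have q: "a * real d ^ n + real R < real q" "real q < b * real d ^ n - real R"
      using n' by linarith+
    \<comment> \<open>The bound \<open>b < 1\<close> keeps \<open>q\<close> below
      \<open>d ^ n\<close>, so that \<open>k * q\<close> is the value of an actual word of length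
      \<open>n\<close>.\<close>
    have "b * real d ^ n \<le> real d ^ n" using \<open>b < 1\<close> mult_right_mono[of b 1 "real d ^ n"] by simp
    then have "real q < real d ^ n" using q by linarith
    then have "q < d ^ n" by (simp only: of_nat_power flip: of_nat_less_iff[where 'a = real])
    then have "q \<le> d ^ n - 1" by linarith
    then have "k * q \<in> digit_value ` words m n" by (simp add: digit_value_words)
    then obtain \<sigma> where \<sigma>: "\<sigma> \<in> words m n" "digit_value \<sigma> = k * q" by force
    have "{- real R..real R} \<subseteq> word_map S \<sigma> -` {a..b}"
      using q k d \<sigma> by (auto simp: word_map_eq words_def field_simps)
    then have sub: "{- real R..real R} \<subseteq> word_map S \<sigma> -` U" using abU by auto
    have cont: "continuous_on UNIV (word_map S \<sigma>)"
      using d k by (auto simp: word_map_eq[abs_def] intro!: continuous_intros)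
    have "word_map S \<sigma> -` U \<in> sets borel"
      using continuous_open_vimage[of U "word_map S \<sigma>"] cont U by (simp add: continuous_on_eq_continuous_at)
    then have "measure \<mu> (word_map S \<sigma> -` U) > 0"
      using R finite_measure_mono[OF sub] by (simp add: sets)
    moreover have "S j \<in> borel_measurable borel" for j
    proof -
      have "S j = (\<lambda>x. (x + real j / real k) / real d)" by (simp add: S_eq fun_eq_iff)
      then show ?thesis by simp
    qed
    moreover have "set \<sigma> \<subseteq> {0..m}" using \<sigma> by (simp add: words_def)
    moreover have "U \<in> sets borel" using U by simp
    ultimately show ?thesis using self_similar_measure_pos[OF \<mu> p] by blast
  qed
  then show "x \<in> measure_support \<mu>" by (simp add: measure_support_def)
qed

end

section \<open>The regular grid and its cells as net intervals\<close>

text \<open>Net intervals involve \<open>K\<close> only through whether it meets open subintervals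
  of \<open>{0<..<1}\<close>, so the inclusion assumed here is the form in which the support
  enters.\<close>

locale cantor_net = cantor_numeration +
  fixes \<rho> :: real and K :: "real set"
  assumes rho: "\<rho> = 1 / real d" and K: "{0<..<1} \<subseteq> K"
begin

definition grid_point :: "nat \<Rightarrow> nat \<Rightarrow> real" where
  "grid_point n i = real i / (real k * real d ^ n)"

definition grid_interval :: "nat \<Rightarrow> nat \<Rightarrow> real \<times> real" where
  "grid_interval n i = (grid_point n i, grid_point n (i + 1))"

lemma grid_denominator_pos: "0 < real k * real d ^ n"
  using d k by simp

lemma grid_point_less_iff [simp]: "grid_point n i < grid_point n j \<longleftrightarrow> i < j"
  unfolding grid_point_def using grid_denominator_pos[of n]
  by (metis divide_less_cancel of_nat_less_iff order_less_asym)

lemma grid_point_le_iff [simp]: "grid_point n i \<le> grid_point n j \<longleftrightarrow> i \<le> j"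
  by (simp flip: linorder_not_less)

lemma grid_point_eq_iff [simp]: "grid_point n i = grid_point n j \<longleftrightarrow> i = j"
  by (simp add: eq_iff)

lemma grid_point_Suc: "grid_point n i = grid_point (Suc n) (d * i)"
  using d by (simp add: grid_point_def)

lemma grid_interval_sel [simp]:
  "fst (grid_interval n i) = grid_point n i" "snd (grid_interval n i) = grid_point n (i + 1)"
  by (simp_all add: grid_interval_def)

lemma inj_grid_interval: "inj (grid_interval n)"
  by (simp add: inj_def grid_interval_def)

lemma grid_size: "k * (d ^ n - 1) + k = k * d ^ n"
proof -
  have "k * (d ^ n - 1) + k * 1 = k * (d ^ n - 1 + 1)" by (simp only: add_mult_distrib2)
  then show ?thesis using d by simp
qed

text \<open>A word of value \<open>N\<close> maps the unit interval onto the stretch from grid index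
  \<open>N\<close> to \<open>N + k\<close>; the two index ranges collect the left and the right
  ends.\<close>

lemma endpoints_eq_Un:
  "endpoints S m n = grid_point n ` ({..k * (d ^ n - 1)} \<union> {k..k * d ^ n})"
proof -
  have "(\<lambda>\<sigma>. word_map S \<sigma> 0) ` words m n = grid_point n ` digit_value ` words m n"
    unfolding image_image by (intro image_cong) (auto simp: word_map_eq words_def grid_point_def)
  moreover have "(\<lambda>\<sigma>. word_map S \<sigma> 1) ` words m n
      = grid_point n ` (\<lambda>N. N + k) ` digit_value ` words m n"
    unfolding image_image using k d
    by (intro image_cong) (auto simp: word_map_eq words_def grid_point_def field_simps)
  moreover have "(\<lambda>N. N + k) ` {..k * (d ^ n - 1)} = {k..k * d ^ n}"
    using image_add_atLeastAtMost'[of k 0 "k * (d ^ n - 1)"] grid_size[of n]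
    by (simp only: atLeast0AtMost add_0)
  ultimately show ?thesis
    by (simp add: endpoints_def digit_value_words image_Un)
qed

text \<open>
  At level 0 the endpoints are only \<open>0\<close> and \<open>1\<close>, which form the full grid just for \<open>k = 1\<close>; this
  explains the recurring side condition \<open>n = 0 \<longrightarrow> k = 1\<close>.
\<close>

lemma endpoints_eq:
  assumes "n = 0 \<longrightarrow> k = 1"
  shows "endpoints S m n = grid_point n ` {..k * d ^ n}"
proof -
  \<comment> \<open>This says that the ranges of left and right ends overlap or abut, leaving no
    grid point out.\<close>
  have "k \<le> k * (d ^ n - 1) + 1"
  proof (cases "n = 0")
    case False
    then have "d \<le> d ^ n" using d by (intro self_le_power) auto
    then have "k * 1 \<le> k * (d ^ n - 1)" using d by (intro mult_le_mono) linarith+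
    then show ?thesis by linarith
  qed (use assms in simp)
  then have "{..k * (d ^ n - 1)} \<union> {k..k * d ^ n} = {..k * d ^ n}"
    using grid_size[of n] by auto
  then show ?thesis by (simp add: endpoints_eq_Un)
qed

lemma net_intervals_eq:
  assumes "n = 0 \<longrightarrow> k = 1"
  shows "net_intervals S m K n = grid_interval n ` {..<k * d ^ n}"
proof (intro equalityI subsetI)
  fix I assume "I \<in> net_intervals S m K n"
  then obtain i j where I: "I = (grid_point n i, grid_point n j)" and ij: "i < j" "j \<le> k * d ^ n"
    and gap: "{grid_point n i<..<grid_point n j} \<inter> endpoints S m n = {}"
    by (auto simp: net_intervals_def endpoints_eq[OF assms])
  \<comment> \<open>The next grid point is itself an endpoint, so a pair with no endpoint in between
    must be adjacent.\<close>
  have "grid_point n (i + 1) \<in> endpoints S m n"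
    unfolding endpoints_eq[OF assms] using ij by (intro imageI) simp
  moreover have "grid_point n i < grid_point n (i + 1)" by simp
  ultimately have "\<not> grid_point n (i + 1) < grid_point n j"
    using gap unfolding disjoint_iff greaterThanLessThan_iff by blast
  then have "j = i + 1" using ij by simp
  then show "I \<in> grid_interval n ` {..<k * d ^ n}"
    using I ij by (auto simp: grid_interval_def)
next
  fix I assume "I \<in> grid_interval n ` {..<k * d ^ n}"
  then obtain i where i: "i < k * d ^ n" and I: "I = grid_interval n i" by blast
  have "grid_point n i \<in> endpoints S m n" "grid_point n (i + 1) \<in> endpoints S m n"
    unfolding endpoints_eq[OF assms] using i by (intro imageI; simp)+
  moreover have "{grid_point n i<..<grid_point n (i + 1)} \<inter> endpoints S m n = {}"
    by (auto simp: endpoints_eq[OF assms])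
  moreover obtain x where x: "grid_point n i < x" "x < grid_point n (i + 1)"
    using dense[of "grid_point n i" "grid_point n (i + 1)"] by auto
  moreover have "x \<in> K"
  proof -
    have "grid_point n 0 = 0" by (simp add: grid_point_def)
    then have "0 < x" using x(1) grid_point_le_iff[of n 0 i] by linarith
    moreover have "grid_point n (k * d ^ n) = 1" using d k by (simp add: grid_point_def)
    then have "x < 1" using x(2) i grid_point_le_iff[of n "i + 1" "k * d ^ n"] by linarith
    ultimately show ?thesis using K by auto
  qed
  ultimately show "I \<in> net_intervals S m K n"
    unfolding I grid_interval_def net_intervals_def by auto
qed

text \<open>Level 0 is treated separately because for \<open>k > 1\<close> the unit interval is not
  a single grid cell.\<close>

lemma net_intervals_0: "net_intervals S m K 0 = {(0, 1)}"
proof -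
  have "endpoints S m 0 = {0, 1}" using k by (auto simp: endpoints_eq_Un grid_point_def)
  moreover have "1 / 2 \<in> {0<..<1} \<inter> K" using K by auto
  then have "{0<..<1} \<inter> K \<noteq> {}" by blast
  ultimately show ?thesis by (auto simp: net_intervals_def)
qed

lemma div_d_eq_iff: "j div d = i \<longleftrightarrow> d * i \<le> j \<and> j < d * i + d"
  using d div_nat_eqI[of d i j] dividend_less_times_div[of d j] by auto

text \<open>On the next finer grid, cell \<open>i\<close> stretches from index \<open>d * i\<close>
  to \<open>d * i + d\<close>, so integer division finds the parent.\<close>

lemma grid_interval_subset_iff:
  "{grid_point (Suc n) j..grid_point (Suc n) (j + 1)} \<subseteq> {grid_point n i..grid_point n (i + 1)}
     \<longleftrightarrow> j div d = i"
proof -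
  have "{grid_point (Suc n) j..grid_point (Suc n) (j + 1)} \<subseteq> {grid_point n i..grid_point n (i + 1)}
    \<longleftrightarrow> d * i \<le> j \<and> j + 1 \<le> d * (i + 1)"
    unfolding grid_point_Suc[of n] atLeastatMost_subset_iff grid_point_le_iff by auto
  also have "\<dots> \<longleftrightarrow> j div d = i"
    by (auto simp: div_d_eq_iff)
  finally show ?thesis .
qed

lemma children_grid_interval:
  assumes n: "n = 0 \<longrightarrow> k = 1" and i: "i < k * d ^ n"
  shows "children S m K n (grid_interval n i) = grid_interval (Suc n) ` {d * i..<d * i + d}"
proof -
  have "children S m K n (grid_interval n i)
      = grid_interval (Suc n) ` {j. j < k * d ^ Suc n \<and> j div d = i}"
  proof -
    have "net_intervals S m K (Suc n) = grid_interval (Suc n) ` {..<k * d ^ Suc n}"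
      by (rule net_intervals_eq) simp
    then show ?thesis
      by (simp only: children_def Compr_image_eq grid_interval_sel grid_interval_subset_iff lessThan_iff)
  qed
  also have "{j. j < k * d ^ Suc n \<and> j div d = i} = {d * i..<d * i + d}"
  proof -
    have "d * (i + 1) \<le> d * (k * d ^ n)" using i by (intro mult_le_mono) auto
    then have "j < k * d ^ Suc n" if "j < d * i + d" for j using that by (simp add: mult_ac)
    then show ?thesis by (auto simp: div_d_eq_iff)
  qed
  finally show ?thesis .
qed

lemma children_root: "children S m K 0 (0, 1) = net_intervals S m K 1"
proof -
  have "{fst I..snd I} \<subseteq> {0..1}" if I: "I \<in> net_intervals S m K 1" for I
  proof -
    have "grid_point 1 0 = 0" "grid_point 1 (k * d) = 1" using d k by (simp_all add: grid_point_def)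
    moreover obtain i where "i < k * d" "I = grid_interval 1 i"
      using I by (auto simp: net_intervals_eq)
    ultimately show ?thesis
      using grid_point_le_iff[of 1 0 i] grid_point_le_iff[of 1 "i + 1" "k * d"] by auto
  qed
  then show ?thesis by (auto simp: children_def)
qed

section \<open>Reduced characteristic vectors and ranks of grid cells\<close>

lemma normalized_length_grid_interval: "normalized_length \<rho> n (grid_interval n i) = 1 / real k"
  using d k by (simp add: normalized_length_def grid_point_def rho field_simps)

text \<open>The image of the unit interval under a word of value \<open>N\<close> consists of the
  \<open>k\<close> cells \<open>N\<close> to \<open>N + k - 1\<close>, and cell \<open>i\<close>
  starts \<open>i - N\<close> cells after its left end.\<close>

lemma neighbours_grid_interval:
  "{(fst (grid_interval n i) - word_map S \<sigma> 0) / \<rho> ^ n | \<sigma>. \<sigma> \<in> words m n \<and>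
      {fst (grid_interval n i)..snd (grid_interval n i)} \<subseteq> word_map S \<sigma> ` {0..1}}
   = (\<lambda>N. (real i - real N) / real k) ` {N. N \<le> k * (d ^ n - 1) \<and> N \<le> i \<and> i < N + k}"
  (is "?A = _")
proof -
  have sub: "{grid_point n i..grid_point n (i + 1)} \<subseteq> word_map S \<sigma> ` {0..1}
      \<longleftrightarrow> digit_value \<sigma> \<le> i \<and> i < digit_value \<sigma> + k" if "\<sigma> \<in> words m n" for \<sigma>
  proof -
    have "word_map S \<sigma> = (\<lambda>x. (1 / real d ^ n) *\<^sub>R x + grid_point n (digit_value \<sigma>))"
      using that d k by (auto simp: word_map_eq words_def grid_point_def add_divide_distrib)
    then have "word_map S \<sigma> ` {0..1}
        = {grid_point n (digit_value \<sigma>)..1 / real d ^ n + grid_point n (digit_value \<sigma>)}"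
      using d image_affinity_atLeastAtMost[of "1 / real d ^ n" "grid_point n (digit_value \<sigma>)" 0 1]
      by simp
    also have "1 / real d ^ n + grid_point n (digit_value \<sigma>) = grid_point n (digit_value \<sigma> + k)"
      using d k by (simp add: grid_point_def add_divide_distrib)
    finally show ?thesis by (auto simp: atLeastatMost_subset_iff)
  qed
  have val: "(grid_point n i - word_map S \<sigma> 0) / \<rho> ^ n = (real i - real (digit_value \<sigma>)) / real k"
    if "\<sigma> \<in> words m n" for \<sigma>
    using that d k
    by (simp add: grid_point_def word_map_eq words_def rho diff_divide_distrib power_one_over
        left_diff_distrib)
  have "?A = (\<lambda>\<sigma>. (grid_point n i - word_map S \<sigma> 0) / \<rho> ^ n)
      ` {\<sigma> \<in> words m n. {grid_point n i..grid_point n (i + 1)} \<subseteq> word_map S \<sigma> ` {0..1}}"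
    by auto
  also have "\<dots> = (\<lambda>\<sigma>. (real i - real (digit_value \<sigma>)) / real k)
      ` {\<sigma> \<in> words m n. digit_value \<sigma> \<le> i \<and> i < digit_value \<sigma> + k}"
    using sub val by (intro image_cong) auto
  also have "\<dots> = (\<lambda>N. (real i - real N) / real k)
      ` {N \<in> digit_value ` words m n. N \<le> i \<and> i < N + k}"
    by auto
  finally show ?thesis by (simp add: digit_value_words)
qed

definition E :: "real \<times> real list" where
  "E = (1 / real k, map (\<lambda>j. real j / real k) [0..<k])"

text \<open>The extreme neighbours decide: \<open>0\<close> requires a word of value
  \<open>i\<close>, and \<open>(k - 1) / k\<close> one of value \<open>i - (k - 1)\<close>. The
  bound \<open>i + k \<le> k * d ^ n\<close> is \<open>i \<le> k * (d ^ n - 1)\<close> without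
  subtraction.\<close>

lemma neighbour_set_grid_interval_iff:
  "neighbour_set S m \<rho> n (grid_interval n i) = snd E \<longleftrightarrow> k - 1 \<le> i \<and> i + k \<le> k * d ^ n"
proof -
  let ?N = "{N. N \<le> k * (d ^ n - 1) \<and> N \<le> i \<and> i < N + k}"
  let ?V = "(\<lambda>N. (real i - real N) / real k) ` ?N"
  have ns: "neighbour_set S m \<rho> n (grid_interval n i) = sorted_list_of_set ?V"
    by (simp only: neighbour_set_def neighbours_grid_interval)
  have "finite ?N" by (rule finite_subset[of _ "{..i}"]) auto
  then have fin: "finite ?V" by simp
  have sd: "sorted (snd E)" "distinct (snd E)"
    using k by (auto simp: E_def sorted_iff_nth_mono distinct_conv_nth divide_right_mono)
  have setE: "set (snd E) = (\<lambda>j. real j / real k) ` {..<k}"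
    by (auto simp: E_def)
  show ?thesis
  proof
    assume eq: "neighbour_set S m \<rho> n (grid_interval n i) = snd E"
    have "?V = set (sorted_list_of_set ?V)" by (rule set_sorted_list_of_set[OF fin, symmetric])
    also have "sorted_list_of_set ?V = snd E" by (rule trans[OF ns[symmetric] eq])
    also note setE
    finally have V: "?V = (\<lambda>j. real j / real k) ` {..<k}" .
    have mem: "\<exists>N. N \<le> k * (d ^ n - 1) \<and> N \<le> i \<and> i - N = j" if "j < k" for j
    proof -
      have "real j / real k \<in> ?V" unfolding V using that by blast
      then obtain N where N: "N \<in> ?N" "real j / real k = (real i - real N) / real k" by blast
      then have "real j = real i - real N" using k by simp
      then show ?thesis using N(1) by (intro exI[of _ N]) auto
    qed
    from mem[of 0] have "i \<le> k * (d ^ n - 1)" using k by auto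
    moreover from mem[of "k - 1"] have "k - 1 \<le> i" using k by auto
    ultimately show "k - 1 \<le> i \<and> i + k \<le> k * d ^ n" using grid_size[of n] by simp
  next
    assume *: "k - 1 \<le> i \<and> i + k \<le> k * d ^ n"
    have "?N = (\<lambda>j. i - j) ` {..<k}"
    proof (intro equalityI subsetI)
      fix N assume "N \<in> ?N"
      then show "N \<in> (\<lambda>j. i - j) ` {..<k}" by (intro image_eqI[of _ _ "i - N"]) auto
    qed (use * grid_size[of n] in auto)
    then have "?V = (\<lambda>j. (real i - real (i - j)) / real k) ` {..<k}" by (simp add: image_image)
    also have "\<dots> = set (snd E)"
      unfolding setE using * by (intro image_cong) (auto simp: of_nat_diff)
    finally show "neighbour_set S m \<rho> n (grid_interval n i) = snd E"
      unfolding ns using sorted_list_of_set.idem_if_sorted_distinct[OF sd] by simp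
  qed
qed

lemma reduced_char_vector_grid_interval_iff:
  "reduced_char_vector S m \<rho> n (grid_interval n i) = E \<longleftrightarrow> k - 1 \<le> i \<and> i + k \<le> k * d ^ n"
  using neighbour_set_grid_interval_iff[of n i]
  by (auto simp: reduced_char_vector_def normalized_length_grid_interval prod_eq_iff E_def)

text \<open>The interval of level 0 has normalized length 1, which equals \<open>1 / k\<close> only
  for \<open>k = 1\<close>; hence every interval of type \<open>E\<close> is a grid cell.\<close>

lemma reduced_char_vector_E_cases:
  assumes "D \<in> net_intervals S m K n" "reduced_char_vector S m \<rho> n D = E"
  obtains i where "n = 0 \<longrightarrow> k = 1" "D = grid_interval n i" "k - 1 \<le> i" "i + k \<le> k * d ^ n"
proof -
  have "n = 0 \<longrightarrow> k = 1"
    using assms k by (auto simp: net_intervals_0 reduced_char_vector_def normalized_length_def E_def)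
  then show ?thesis
    using assms that by (auto simp: net_intervals_eq reduced_char_vector_grid_interval_iff)
qed

text \<open>The parent is unique and all siblings have the same normalized length, so the rank is
  just the position among the \<open>d\<close> children, counted from 1.\<close>

lemma sibling_rank_grid_interval:
  assumes n: "n = 0 \<longrightarrow> k = 1" and i: "i < k * d ^ n" and t: "t < d"
  shows "sibling_rank S m \<rho> K (Suc n) (grid_interval (Suc n) (d * i + t)) = t + 1"
proof -
  let ?I = "grid_interval (Suc n) (d * i + t)"
  have div: "(d * i + t) div d = i" using t by simp
  have unique: "D = grid_interval n i"
    if D: "D \<in> net_intervals S m K n" and I: "?I \<in> children S m K n D" for D
  proof -
    obtain i' where i': "D = grid_interval n i'"
      using D unfolding net_intervals_eq[OF n] by blast
    with I have "(d * i + t) div d = i'"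
      using grid_interval_subset_iff[of n "d * i + t" i'] by (simp add: children_def)
    then show ?thesis using i' div by simp
  qed
  have ch: "children S m K n (grid_interval n i) = grid_interval (Suc n) ` {d * i..<d * i + d}"
    by (rule children_grid_interval[OF n i])
  have "{J. (\<exists>D\<in>net_intervals S m K n. ?I \<in> children S m K n D \<and> J \<in> children S m K n D) \<and>
       normalized_length \<rho> (Suc n) J = normalized_length \<rho> (Suc n) ?I \<and> fst J \<le> fst ?I}
    = {J \<in> children S m K n (grid_interval n i).
       normalized_length \<rho> (Suc n) J = normalized_length \<rho> (Suc n) ?I \<and> fst J \<le> fst ?I}"
  proof -
    have "grid_interval n i \<in> net_intervals S m K n" unfolding net_intervals_eq[OF n] using i by simp
    moreover have "?I \<in> children S m K n (grid_interval n i)" using t ch by simp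
    ultimately show ?thesis using unique by blast
  qed
  also have "\<dots> = grid_interval (Suc n) ` {d * i..d * i + t}"
    using t by (auto simp: ch normalized_length_grid_interval)
  finally show ?thesis
    by (simp add: sibling_rank_def card_image inj_on_subset[OF inj_grid_interval])
qed

lemma char_vector_child:
  assumes n: "n = 0 \<longrightarrow> k = 1" and i: "k - 1 \<le> i" "i + k \<le> k * d ^ n" and t: "t < d"
  shows "reduced_char_vector S m \<rho> (Suc n) (grid_interval (Suc n) (d * i + t)) = E"
    and "char_vector S m \<rho> K (Suc n) (grid_interval (Suc n) (d * i + t)) = (fst E, snd E, t + 1)"
proof -
  have "1 * i \<le> d * i" using d by (intro mult_le_mono) auto
  then have "k - 1 \<le> d * i + t" using i(1) by linarith
  moreover have "d * i + t + k \<le> k * d ^ Suc n"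
  proof -
    \<comment> \<open>This is \<open>(d - 1) * (k - 1) \<ge> 0\<close> written out; with
      \<open>t \<le> d - 1\<close> it gives \<open>t + k \<le> d * k\<close>.\<close>
    have "d + k \<le> d * k + 1" using d k by (cases d; cases k) auto
    moreover have "d * (i + k) \<le> d * (k * d ^ n)" using i(2) by (intro mult_le_mono) auto
    ultimately show ?thesis using t by (simp add: algebra_simps)
  qed
  ultimately show red: "reduced_char_vector S m \<rho> (Suc n) (grid_interval (Suc n) (d * i + t)) = E"
    by (simp add: reduced_char_vector_grid_interval_iff del: power_Suc)
  have "i < k * d ^ n" using i k by simp
  from sibling_rank_grid_interval[OF n this t] red
  show "char_vector S m \<rho> K (Suc n) (grid_interval (Suc n) (d * i + t)) = (fst E, snd E, t + 1)"
    by (simp add: char_vector_def reduced_char_vector_def prod_eq_iff)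
qed

section \<open>Transition matrices between cells of type \<open>E\<close>\<close>

text \<open>Neighbour \<open>x\<close> of the parent belongs to the value \<open>i - x\<close>,
  neighbour \<open>y\<close> of the child to \<open>d * i + t - y\<close>. Appending
  \<open>w\<close> turns the first value into \<open>d * (i - x) + w\<close>, and equating the two
  determines \<open>w\<close>.\<close>

lemma transition_letter_iff:
  assumes i: "k - 1 \<le> i" "i + k \<le> k * d ^ n" and n: "n = 0 \<longrightarrow> k = 1" and t: "t < d"
    and xy: "x < k" "y < k"
  shows "transition_letter S m \<rho> n (grid_interval n i) (grid_interval (Suc n) (d * i + t)) x y w
    \<longleftrightarrow> w \<le> m \<and> int w = int d * int x - int y + int t"
proof -
  have word_map_0: "word_map S \<sigma> 0 = grid_point (length \<sigma>) (digit_value \<sigma>)" for \<sigma>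
    by (simp add: word_map_eq grid_point_def)
  have shift: "grid_point l a - \<rho> ^ l * (real z / real k) = grid_point l (a - z)" if "z \<le> a" for l a z
    using that d k by (simp add: grid_point_def rho of_nat_diff diff_divide_distrib power_one_over)
  have nth: "snd E ! z = real z / real k" if "z < k" for z
    using that by (simp add: E_def)
  have ns: "neighbour_set S m \<rho> n (grid_interval n i) = snd E"
    using i by (simp add: neighbour_set_grid_interval_iff)
  have ns': "neighbour_set S m \<rho> (Suc n) (grid_interval (Suc n) (d * i + t)) = snd E"
    using char_vector_child(1)[OF n i t] by (simp add: reduced_char_vector_def prod_eq_iff)
  have x: "x \<le> i" using xy i by linarith
  have "1 * i \<le> d * i" using d by (intro mult_le_mono) auto
  then have y: "y \<le> d * i + t" using xy i by linarith
  have "transition_letter S m \<rho> n (grid_interval n i) (grid_interval (Suc n) (d * i + t)) x y w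
    \<longleftrightarrow> w \<le> m \<and> (\<exists>\<sigma>\<in>words m n. digit_value \<sigma> = i - x \<and> digit_value (\<sigma> @ [w]) = d * i + t - y)"
    unfolding transition_letter_def ns ns' nth[OF xy(1)] nth[OF xy(2)] grid_interval_sel
      shift[OF x] shift[OF y] word_map_0
    by (auto simp: words_def simp del: digit_value_simps)
  also have "\<dots> \<longleftrightarrow> w \<le> m \<and> d * (i - x) + w = d * i + t - y"
  proof -
    \<comment> \<open>Since the parent has type \<open>E\<close>, a word for each of its
      \<open>k\<close> neighbours exists, so only the equation for \<open>w\<close> remains.\<close>
    have "i - x \<in> digit_value ` words m n"
      using i grid_size[of n] by (simp add: digit_value_words)
    then show ?thesis by (auto simp: image_iff)
  qed
  also have "d * (i - x) + w = d * i + t - y \<longleftrightarrow> int w = int d * int x - int y + int t"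
  proof -
    have "d * (i - x) + w = d * i + t - y \<longleftrightarrow> int (d * (i - x) + w) = int (d * i + t - y)"
      by (simp only: of_nat_eq_iff)
    also have "\<dots> \<longleftrightarrow> int w = int d * int x - int y + int t"
      using x y by (auto simp: of_nat_diff right_diff_distrib)
    finally show ?thesis .
  qed
  finally show ?thesis .
qed

lemma transition_matrix_grid_interval:
  assumes i: "k - 1 \<le> i" "i + k \<le> k * d ^ n" and n: "n = 0 \<longrightarrow> k = 1" and t: "t < d"
  shows "transition_matrix S m \<rho> p n (grid_interval n i) (grid_interval (Suc n) (d * i + t)) =
    mat k k (\<lambda>(x, y). let q = int d * int x - int y + int t
                      in if 0 \<le> q \<and> q \<le> int m then p (nat q) else 0)"
proof -
  have "neighbour_set S m \<rho> n (grid_interval n i) = snd E"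
    using i by (simp add: neighbour_set_grid_interval_iff)
  moreover have "neighbour_set S m \<rho> (Suc n) (grid_interval (Suc n) (d * i + t)) = snd E"
    using char_vector_child(1)[OF n i t] by (simp add: reduced_char_vector_def prod_eq_iff)
  moreover have "length (snd E) = k" by (simp add: E_def)
  moreover have "(if \<exists>w. transition_letter S m \<rho> n (grid_interval n i) (grid_interval (Suc n) (d * i + t)) x y w
      then p (THE w. transition_letter S m \<rho> n (grid_interval n i) (grid_interval (Suc n) (d * i + t)) x y w)
      else 0) = (let q = int d * int x - int y + int t
        in if 0 \<le> q \<and> q \<le> int m then p (nat q) else 0)" if "x < k" "y < k" for x y
  proof -
    define q where "q = int d * int x - int y + int t"
    \<comment> \<open>The only possible letter is \<open>nat q\<close>, which resolves both the
      existence test and \<open>THE\<close>.\<close>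
    have iff: "w \<le> m \<and> int w = q \<longleftrightarrow> 0 \<le> q \<and> q \<le> int m \<and> w = nat q" for w by auto
    show ?thesis
      unfolding transition_letter_iff[OF i n t that] q_def[symmetric] iff Let_def by auto
  qed
  ultimately show ?thesis
    unfolding transition_matrix_def by (intro cong_mat) auto
qed

section \<open>Existence and uniqueness of the essential class\<close>

lemma ex_char_vector_child:
  assumes n: "n = 0 \<longrightarrow> k = 1" and i: "k - 1 \<le> i" "i + k \<le> k * d ^ n"
    and r: "r \<in> {1..d}"
  shows "\<exists>I \<in> children S m K n (grid_interval n i).
    char_vector S m \<rho> K (Suc n) I = (fst E, snd E, r)"
proof
  have "i < k * d ^ n" using i k by linarith
  then show "grid_interval (Suc n) (d * i + (r - 1)) \<in> children S m K n (grid_interval n i)"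
    using r unfolding children_grid_interval[OF n \<open>i < k * d ^ n\<close>] by (intro imageI) auto
  have "r - 1 < d" "r - 1 + 1 = r" using r by auto
  then show "char_vector S m \<rho> K (Suc n) (grid_interval (Suc n) (d * i + (r - 1))) = (fst E, snd E, r)"
    using char_vector_child(2)[OF n i, of "r - 1"] by simp
qed

text \<open>
  For \<open>k > 1\<close>, ranks above \<open>d\<close> occur with reduced vector \<open>E\<close> at level 1 (whose cells are all children of
  \<open>[0, 1]\<close>), but they lie outside the essential class.
\<close>

definition E_class :: "(real \<times> real list \<times> nat) set" where
  "E_class = (\<lambda>r. (fst E, snd E, r)) ` {1..d}"

lemma reduce_E_class: "reduce ` E_class = {E}"
proof -
  have "reduce (fst E, snd E, r) = E" for r by (simp add: reduce_def)
  moreover have "{1..d} \<noteq> {}" using d by simp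
  ultimately show ?thesis unfolding E_class_def image_image by (simp only: image_constant_conv if_False)
qed

lemma E_class_closed:
  assumes "\<alpha> \<in> E_class" "(\<alpha>, \<beta>) \<in> child_rel S m \<rho> K"
  shows "\<beta> \<in> E_class"
proof -
  obtain n D I where D: "D \<in> net_intervals S m K n" "\<alpha> = char_vector S m \<rho> K n D"
    and I: "I \<in> children S m K n D" "\<beta> = char_vector S m \<rho> K (Suc n) I"
    using assms(2) by (auto simp: child_rel_def)
  have "reduced_char_vector S m \<rho> n D = E"
    using assms(1) D(2) by (auto simp: E_class_def char_vector_def reduced_char_vector_def)
  with D(1) obtain i where n: "n = 0 \<longrightarrow> k = 1" and i: "D = grid_interval n i" "k - 1 \<le> i" "i + k \<le> k * d ^ n"
    by (rule reduced_char_vector_E_cases)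
  have "i < k * d ^ n" using i k by linarith
  then obtain j where j: "d * i \<le> j" "j < d * i + d" "I = grid_interval (Suc n) j"
    using I(1) by (auto simp: i(1) children_grid_interval[OF n])
  moreover from j have "j = d * i + (j - d * i)" "j - d * i < d" by auto
  ultimately have "\<beta> = (fst E, snd E, j - d * i + 1)"
    using I(2) char_vector_child(2)[OF n i(2,3), of "j - d * i"] by simp
  then show ?thesis using \<open>j - d * i < d\<close> by (auto simp: E_class_def)
qed

text \<open>Any interval realizing \<open>\<alpha>\<close> is a cell of type \<open>E\<close> and
  has children of all ranks from 1 to \<open>d\<close>, so a single step leads to every member of
  the class.\<close>

lemma E_class_child_rel:
  assumes \<alpha>: "\<alpha> \<in> E_class" "\<alpha> \<in> char_vectors S m \<rho> K" and \<beta>: "\<beta> \<in> E_class"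
  shows "(\<alpha>, \<beta>) \<in> child_rel S m \<rho> K"
proof -
  obtain n D where D: "D \<in> net_intervals S m K n" "\<alpha> = char_vector S m \<rho> K n D"
    using \<alpha>(2) by (auto simp: char_vectors_def)
  have "reduced_char_vector S m \<rho> n D = E"
    using \<alpha>(1) D(2) by (auto simp: E_class_def char_vector_def reduced_char_vector_def)
  with D(1) obtain i where n: "n = 0 \<longrightarrow> k = 1" and i: "D = grid_interval n i" "k - 1 \<le> i" "i + k \<le> k * d ^ n"
    by (rule reduced_char_vector_E_cases)
  obtain r where "r \<in> {1..d}" "\<beta> = (fst E, snd E, r)" using \<beta> by (auto simp: E_class_def)
  then obtain I where "I \<in> children S m K n D" "char_vector S m \<rho> K (Suc n) I = \<beta>"
    using ex_char_vector_child[OF n i(2,3)] i(1) by blast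
  then show ?thesis using D unfolding child_rel_def by blast
qed

lemma essential_class_E_class: "essential_class S m \<rho> K E_class"
proof -
  have "E_class \<noteq> {}" using d by (auto simp: E_class_def)
  moreover have sub: "E_class \<subseteq> char_vectors S m \<rho> K"
  proof
    fix \<beta> assume "\<beta> \<in> E_class"
    then obtain r where r: "r \<in> {1..d}" "\<beta> = (fst E, snd E, r)" by (auto simp: E_class_def)
    \<comment> \<open>Cell \<open>k - 1\<close> of level 1 is the leftmost one of type
      \<open>E\<close>; its children realize the whole class at level 2.\<close>
    have "k * 2 \<le> k * d" using d by (intro mult_le_mono) auto
    then have "k - 1 + k \<le> k * d ^ 1" unfolding power_one_right by linarith
    then obtain I where "I \<in> children S m K 1 (grid_interval 1 (k - 1))"
      "char_vector S m \<rho> K (Suc 1) I = \<beta>"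
      using ex_char_vector_child[of 1 "k - 1" r] r by auto
    then show "\<beta> \<in> char_vectors S m \<rho> K"
      unfolding char_vectors_def children_def by blast
  qed
  moreover have "(\<alpha>, \<beta>) \<in> (child_rel S m \<rho> K \<inter> E_class \<times> E_class)\<^sup>+"
    if "\<alpha> \<in> E_class" "\<beta> \<in> E_class" for \<alpha> \<beta>
    using E_class_child_rel[of \<alpha> \<beta>] that sub by (intro r_into_trancl) auto
  ultimately show ?thesis
    using E_class_closed by (auto simp: essential_class_def loop_class_def)
qed

text \<open>The descendants of cell \<open>i\<close> after \<open>s\<close> generations are the
  cells from \<open>d ^ s * i\<close> up to just below \<open>d ^ s * (i + 1)\<close>, and closure
  under children carries membership in \<open>L\<close> down to each of them.\<close>

lemma char_vector_descendant:
  assumes L: "\<And>\<alpha> \<beta>. \<alpha> \<in> L \<Longrightarrow> (\<alpha>, \<beta>) \<in> child_rel S m \<rho> K \<Longrightarrow> \<beta> \<in> L"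
    and n: "n = 0 \<longrightarrow> k = 1" and i: "i < k * d ^ n"
    and "char_vector S m \<rho> K n (grid_interval n i) \<in> L"
    and "d ^ s * i \<le> j" "j < d ^ s * (i + 1)"
  shows "char_vector S m \<rho> K (n + s) (grid_interval (n + s) j) \<in> L"
  using assms(5,6)
proof (induction s arbitrary: j)
  case 0
  then have "j = i" by simp
  then show ?case using assms(4) by simp
next
  case (Suc s)
  let ?j = "j div d"
  have "d * (d ^ s * i) \<le> j" "j < d * (d ^ s * (i + 1))" using Suc.prems by (simp_all add: mult_ac)
  then have j: "d ^ s * i \<le> ?j" "?j < d ^ s * (i + 1)"
    using d by (auto simp: less_eq_div_iff_mult_less_eq div_less_iff_less_mult mult.commute)
  have ns: "n + s = 0 \<longrightarrow> k = 1" using n by simp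
  have "d ^ s * (i + 1) \<le> d ^ s * (k * d ^ n)" using i by (intro mult_le_mono) auto
  then have lt: "?j < k * d ^ (n + s)" using j(2) by (simp add: power_add mult_ac)
  have "j \<in> {d * ?j..<d * ?j + d}" using div_d_eq_iff[of j ?j] by simp
  then have "grid_interval (Suc (n + s)) j \<in> children S m K (n + s) (grid_interval (n + s) ?j)"
    unfolding children_grid_interval[OF ns lt] by blast
  moreover have "grid_interval (n + s) ?j \<in> net_intervals S m K (n + s)"
    unfolding net_intervals_eq[OF ns] using lt by blast
  ultimately have "(char_vector S m \<rho> K (n + s) (grid_interval (n + s) ?j),
      char_vector S m \<rho> K (Suc (n + s)) (grid_interval (Suc (n + s)) j)) \<in> child_rel S m \<rho> K"
    unfolding child_rel_def by blast
  with Suc.IH[OF j] show ?case using L by simp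
qed

text \<open>Some descendant of any interval is far enough from the boundary to have type
  \<open>E\<close>, and closure under children puts its vectors into \<open>L\<close>.\<close>

lemma essential_class_meets_E_class:
  assumes "essential_class S m \<rho> K L"
  shows "L \<inter> E_class \<noteq> {}"
proof -
  have closed: "\<beta> \<in> L" if "\<alpha> \<in> L" "(\<alpha>, \<beta>) \<in> child_rel S m \<rho> K" for \<alpha> \<beta>
    using assms that unfolding essential_class_def by blast
  obtain n D where D: "D \<in> net_intervals S m K n" "char_vector S m \<rho> K n D \<in> L"
    using assms unfolding essential_class_def loop_class_def char_vectors_def by blast
  \<comment> \<open>An interval of level 0 is replaced by its first child, so that the start is a
    grid cell.\<close>
  obtain n i where n: "n \<noteq> 0" and i: "i < k * d ^ n"
    and L: "char_vector S m \<rho> K n (grid_interval n i) \<in> L"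
  proof (cases "n = 0")
    case True
    have "grid_interval 1 0 \<in> children S m K 0 D"
      using D(1) True d k by (auto simp: net_intervals_0 children_root net_intervals_eq)
    then have "(char_vector S m \<rho> K 0 D, char_vector S m \<rho> K (Suc 0) (grid_interval 1 0)) \<in> child_rel S m \<rho> K"
      using D(1) True unfolding child_rel_def by blast
    then have "char_vector S m \<rho> K 1 (grid_interval 1 0) \<in> L"
      using closed D(2) True by simp
    then show ?thesis using that[of 1 0] d k by simp
  next
    case False
    then show ?thesis using D that by (auto simp: net_intervals_eq)
  qed
  \<comment> \<open>After \<open>2 * k\<close> generations there are more than \<open>2 * k\<close>
    descendants; the one at offset \<open>k\<close> keeps the margins required for type
    \<open>E\<close> on both sides.\<close>
  have "2 * k < 2 ^ (2 * k)" by (rule less_exp)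
  also have "\<dots> \<le> d ^ (2 * k)" using d by (rule power_mono) simp
  finally have s: "2 * k < d ^ (2 * k)" .
  define s where "s = 2 * k"
  define j where "j = d ^ s * i + k"
  have "char_vector S m \<rho> K (n + s) (grid_interval (n + s) j) \<in> L"
    using n i L s by (intro char_vector_descendant[OF closed]) (auto simp: j_def s_def)
  have "d ^ s * (i + 1) \<le> d ^ s * (k * d ^ n)" using i by (intro mult_le_mono) auto
  then have j: "k - 1 \<le> j" "j + k \<le> k * d ^ (n + s)"
    using s by (simp_all add: j_def s_def power_add mult_ac)
  have ns: "n + s = 0 \<longrightarrow> k = 1" using n by simp
  \<comment> \<open>Descending once more fixes the rank as well: the first child has rank 1 and
    hence a vector in \<open>E_class\<close>.\<close>
  obtain I where I: "I \<in> children S m K (n + s) (grid_interval (n + s) j)"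
      "char_vector S m \<rho> K (Suc (n + s)) I = (fst E, snd E, 1)"
    using ex_char_vector_child[OF ns j, of 1] d by auto
  have "j < k * d ^ (n + s)" using j k by linarith
  then have "grid_interval (n + s) j \<in> net_intervals S m K (n + s)"
    unfolding net_intervals_eq[OF ns] by blast
  then have "(char_vector S m \<rho> K (n + s) (grid_interval (n + s) j), (fst E, snd E, 1)) \<in> child_rel S m \<rho> K"
    using I(1) unfolding child_rel_def I(2)[symmetric] by blast
  then have "(fst E, snd E, 1) \<in> L" using closed \<open>char_vector S m \<rho> K (n + s) _ \<in> L\<close> by blast
  moreover have "(fst E, snd E, 1) \<in> E_class" using d by (auto simp: E_class_def)
  ultimately show ?thesis by blast
qed

lemma essential_class_iff: "essential_class S m \<rho> K L \<longleftrightarrow> L = E_class"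
  using essential_class_E_class essential_class_meets_E_class
    essential_class_subset[of S m \<rho> K] by (metis inf_commute subset_antisym)

section \<open>Level one, and the three claims for the measure itself\<close>

lemma level_one_E:
  "{I \<in> net_intervals S m K 1. reduced_char_vector S m \<rho> 1 I = E} = grid_interval 1 ` {k - 1..m}"
proof -
  have "net_intervals S m K 1 = grid_interval 1 ` {..<k * d ^ 1}"
    by (rule net_intervals_eq) simp
  then have "{I \<in> net_intervals S m K 1. reduced_char_vector S m \<rho> 1 I = E}
      = grid_interval 1 ` {i. i < k * d ^ 1 \<and> reduced_char_vector S m \<rho> 1 (grid_interval 1 i) = E}"
    by (simp only: Compr_image_eq lessThan_iff)
  also have "{i. i < k * d ^ 1 \<and> reduced_char_vector S m \<rho> 1 (grid_interval 1 i) = E} = {k - 1..m}"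
  proof (rule Set.set_eqI)
    fix i
    have "i < k * d ^ 1 \<and> k - 1 \<le> i \<and> i + k \<le> k * d ^ 1 \<longleftrightarrow> k - 1 \<le> i \<and> i \<le> m"
      using grid_size[of 1] k unfolding power_one_right m by linarith
    then show "i \<in> {i. i < k * d ^ 1 \<and> reduced_char_vector S m \<rho> 1 (grid_interval 1 i) = E}
        \<longleftrightarrow> i \<in> {k - 1..m}"
      by (simp only: mem_Collect_eq atLeastAtMost_iff reduced_char_vector_grid_interval_iff)
  qed
  finally show ?thesis .
qed

end

theorem proposition5p1:
  fixes d k m :: nat and p :: "nat \<Rightarrow> real" and \<mu> :: "real measure"
    and S :: "nat \<Rightarrow> real \<Rightarrow> real" and \<rho> :: real and K :: "real set"
    and E :: "real \<times> real list"
  assumes d: "d \<ge> 2" and k: "k \<ge> 1" and m: "m = k * (d - 1)"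
    and S: "S = cantor_ifs d m" and \<rho>: "\<rho> = 1 / real d"
    and p_pos: "\<And>j. j \<le> m \<Longrightarrow> p j > 0" and p_sum: "(\<Sum>j\<le>m. p j) = 1"
    and \<mu>: "self_similar_measure S m p \<mu>" and K: "K = measure_support \<mu>"
    and E: "E = (1 / real k, map (\<lambda>j. real j / real k) [0..<k])"
  shows
    \<comment> \<open>(1)\<close>
    "((\<exists>!L. essential_class S m \<rho> K L) \<and>
      (\<forall>L. essential_class S m \<rho> K L \<longrightarrow> reduce ` L = {E}) \<and>
      (\<forall>n. \<forall>D \<in> net_intervals S m K n. reduced_char_vector S m \<rho> n D = E \<longrightarrow>
         card (children S m K n D) = d \<and>
         (\<forall>I \<in> children S m K n D. reduced_char_vector S m \<rho> (Suc n) I = E)))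
    \<and>
     (card {I \<in> net_intervals S m K 1. reduced_char_vector S m \<rho> 1 I = E} = m - k + 2 \<and>
      {I \<in> net_intervals S m K 1. reduced_char_vector S m \<rho> 1 I = E} =
        (\<lambda>i. (real (i - 1) / (real k * real d), real i / (real k * real d))) ` {k..m + 1} \<and>
      (real ((m + 1) - 1) / (real k * real d), real (m + 1) / (real k * real d)) =
        (1 - real k / (real k * real d), 1 - (real k - 1) / (real k * real d)))
    \<and>
     (\<forall>n. \<forall>D \<in> net_intervals S m K n. reduced_char_vector S m \<rho> n D = E \<longrightarrow>
        (\<exists>C :: nat \<Rightarrow> real \<times> real.
           bij_betw C {1..d} (children S m K n D) \<and>
           strict_mono_on {1..d} (\<lambda>i. fst (C i)) \<and>
           (\<forall>i \<in> {1..d}. transition_matrix S m \<rho> p n D (C i) =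
              mat k k (\<lambda>(x, y).
                let q = int d * int x - int y + int i - 1
                in if 0 \<le> q \<and> q \<le> int m then p (nat q) else 0))))"
proof -
  interpret cantor_numeration d k m S by unfold_locales fact+
  have "{0<..<1} \<subseteq> K" unfolding K by (rule open_unit_interval_in_support[OF \<mu> p_pos])
  then interpret net: cantor_net d k m S \<rho> K by unfold_locales (use \<rho> in auto)
  have E': "E = net.E" by (simp add: E net.E_def)
  have children_E: "card (children S m K n D) = d \<and>
      (\<forall>I \<in> children S m K n D. reduced_char_vector S m \<rho> (Suc n) I = E) \<and>
      (\<exists>C :: nat \<Rightarrow> real \<times> real.
           bij_betw C {1..d} (children S m K n D) \<and>
           strict_mono_on {1..d} (\<lambda>i. fst (C i)) \<and>
           (\<forall>i \<in> {1..d}. transition_matrix S m \<rho> p n D (C i) =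
              mat k k (\<lambda>(x, y).
                let q = int d * int x - int y + int i - 1
                in if 0 \<le> q \<and> q \<le> int m then p (nat q) else 0)))"
    if D: "D \<in> net_intervals S m K n" "reduced_char_vector S m \<rho> n D = E" for n D
  proof -
    obtain i where n: "n = 0 \<longrightarrow> k = 1" and Di: "D = net.grid_interval n i"
      and i: "k - 1 \<le> i" "i + k \<le> k * d ^ n"
      using D unfolding E' by (rule net.reduced_char_vector_E_cases)
    have "i < k * d ^ n" using i k by linarith
    then have ch: "children S m K n D = net.grid_interval (Suc n) ` {d * i..<d * i + d}"
      using net.children_grid_interval[OF n] Di by simp
    \<comment> \<open>Children are labelled from 1 but offsets start at 0; this shift produces the
      \<open>- 1\<close> in the matrix index.\<close>
    define C where "C = (\<lambda>j. net.grid_interval (Suc n) (d * i + (j - 1)))"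
    have "(\<lambda>j. d * i + (j - 1)) ` {1..d} = {d * i..<d * i + d}"
    proof (intro equalityI subsetI)
      fix j assume "j \<in> {d * i..<d * i + d}"
      then show "j \<in> (\<lambda>j. d * i + (j - 1)) ` {1..d}"
        by (intro image_eqI[of _ _ "j - d * i + 1"]) auto
    qed auto
    then have C_img: "C ` {1..d} = children S m K n D"
      unfolding ch by (metis (no_types, lifting) C_def image_cong image_image)
    have mono: "strict_mono_on {1..d} (\<lambda>i. fst (C i))"
      by (auto simp: strict_mono_on_def C_def)
    then have "inj_on (\<lambda>i. fst (C i)) {1..d}" by (rule strict_mono_on_imp_inj_on)
    then have "inj_on C {1..d}" by (intro inj_on_imageI2[of fst]) (simp add: o_def)
    then have bij: "bij_betw C {1..d} (children S m K n D)" using C_img by (simp add: bij_betw_def)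
    have "transition_matrix S m \<rho> p n D (C j) = mat k k (\<lambda>(x, y).
        let q = int d * int x - int y + int j - 1 in if 0 \<le> q \<and> q \<le> int m then p (nat q) else 0)"
      if j: "j \<in> {1..d}" for j
    proof -
      have "int (j - 1) = int j - 1" "j - 1 < d" using j by auto
      then show ?thesis
        unfolding Di C_def using net.transition_matrix_grid_interval[OF i n, of "j - 1" p]
        by (simp only: add_diff_eq)
    qed
    moreover have "card (children S m K n D) = d" using bij_betw_same_card[OF bij] by simp
    moreover have "reduced_char_vector S m \<rho> (Suc n) I = E" if "I \<in> children S m K n D" for I
    proof -
      obtain j where "j \<in> {1..d}" "I = C j" using C_img \<open>I \<in> _\<close> by blast
      then show ?thesis
        unfolding E' C_def using net.char_vector_child(1)[OF n i, of "j - 1"] by auto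
    qed
    ultimately show ?thesis using bij mono by blast
  qed
  have img: "(\<lambda>i. (real (i - 1) / (real k * real d), real i / (real k * real d))) ` {k..m + 1}
      = net.grid_interval 1 ` {k - 1..m}"
  proof -
    have "{k..m + 1} = Suc ` {k - 1..m}" using k image_Suc_atLeastAtMost[of "k - 1" m] by simp
    then show ?thesis
      unfolding net.grid_interval_def net.grid_point_def by (simp only: image_image) simp
  qed
  have "card (net.grid_interval 1 ` {k - 1..m}) = Suc m - (k - 1)"
    by (simp add: card_image inj_on_subset[OF net.inj_grid_interval])
  \<comment> \<open>From \<open>d \<ge> 2\<close>; it keeps the natural subtraction in
    \<open>m - k + 2\<close> from truncating.\<close>
  moreover have "k \<le> m" unfolding m using d by auto
  then have "Suc m - (k - 1) = m - k + 2" using k by simp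
  moreover have "real m = real k * real d - real k" using m d by (simp add: of_nat_diff algebra_simps)
  then have "(real ((m + 1) - 1) / (real k * real d), real (m + 1) / (real k * real d)) =
      (1 - real k / (real k * real d), 1 - (real k - 1) / (real k * real d))"
    using k d by (simp add: field_simps)
  ultimately show ?thesis
    unfolding img using net.level_one_E net.essential_class_iff net.reduce_E_class children_E by (simp add: E')
qed

end
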